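(* Let $u$ be a coherent utility function with determining set $\mathcal D$, $X=(X^1,\dots,X^d)$ with $X^i\in L^1_w(\mathcal D)$, and let $H\subset\mathbb R^d$ be a convex compact set with $0\in H$. Put $$G=\mathrm{cl}\{\mathsf E_{\mathsf Q}X:\mathsf Q\in\mathcal D\},\qquad H^*=\{x\in\mathbb R^d:\langle h,x\rangle\le1\ \forall h\in H\},\qquad \lambda_*=\inf\{\lambda\ge0:\lambda H^*\cap G\ne\emptyset\},$$ $$N=\begin{cases}\{h\in\mathbb R^d:\langle h,x\rangle\le\lambda_*\le\langle h,y\rangle\ \ \forall x\in\lambda_*H^*,\ \forall y\in G\}&\text{if }\lambda_*>0,\\ \emptyset&\text{if }\lambda_*=0.\end{cases}$$ Then $\sup_{h\in H}u(\langle h,X\rangle)=\lambda_*$ and $\mathop{\rm argmax}_{h\in H}u(\langle h,X\rangle)=N$.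
   Context: $(\Omega,\mathcal F,\mathsf P)$ is a probability space, $L^0$ is the space of real random variables, and $\mathcal P$ is the set of probability measures absolutely continuous with respect to $\mathsf P$. $\mathsf E_{\mathsf Q}X=\mathsf E_{\mathsf Q}X^+-\mathsf E_{\mathsf Q}X^-$ with $\infty-\infty=-\infty$. A coherent utility function is a map $u:L^0\to[-\infty,\infty]$ of the form $u(X)=\inf_{\mathsf Q\in\mathcal D}\mathsf E_{\mathsf Q}X$ with nonempty $\mathcal D\subset\mathcal P$; its determining set is the largest such $\mathcal D$ (it is convex). $L^1_w(\mathcal D)=\{X\in L^0:u(X)>-\infty,\ u(-X)>-\infty\}$. "$\mathrm{cl}$" denotes closure.
   Formalization: For λ_*=0 the claim argmax=N=∅ is false (h=0∈H always attains the supremum 0, e.g. X=0, H={0}); the formal theorem claims argmax=N only for λ_*>0, and for λ_*=0 proves argmax={h∈H: ⟨h,y⟩≥0 for all y∈G}. *)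

theory Defs
  imports "HOL-Probability.Probability"
begin

definition abs_cont_probs :: "'a measure \<Rightarrow> 'a measure set" where
  "abs_cont_probs M = {Q. prob_space Q \<and> sets Q = sets M \<and> absolutely_continuous M Q}"

text \<open>The case distinction implements the convention that infinity minus infinity is
  minus infinity; subtraction on \<^typ>\<open>ereal\<close> would give plus infinity.\<close>

definition ext_expectation :: "'a measure \<Rightarrow> ('a \<Rightarrow> real) \<Rightarrow> ereal" where
  "ext_expectation Q Y =
     (let p = \<integral>\<^sup>+\<omega>. ennreal (max 0 (Y \<omega>)) \<partial>Q; n = \<integral>\<^sup>+\<omega>. ennreal (max 0 (- Y \<omega>)) \<partial>Q
      in if p = \<infinity> \<and> n = \<infinity> then -\<infinity> else enn2ereal p - enn2ereal n)"

text \<open>\<open>L\<^sup>0\<close> is \<^term>\<open>borel_measurable M\<close>, without passing to classes modulo null sets: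
  expectations under absolutely continuous measures do not see the difference. The values of
  \<open>u\<close> outside of \<open>L\<^sup>0\<close> are irrelevant.\<close>

definition represents_utility ::
    "'a measure \<Rightarrow> (('a \<Rightarrow> real) \<Rightarrow> ereal) \<Rightarrow> 'a measure set \<Rightarrow> bool" where
  "represents_utility M u D \<longleftrightarrow> D \<noteq> {} \<and> D \<subseteq> abs_cont_probs M \<and>
     (\<forall>Y\<in>borel_measurable M. u Y = (INF Q\<in>D. ext_expectation Q Y))"

definition coherent_utility :: "'a measure \<Rightarrow> (('a \<Rightarrow> real) \<Rightarrow> ereal) \<Rightarrow> bool" where
  "coherent_utility M u \<longleftrightarrow> (\<exists>D. represents_utility M u D)"

definition determining_set :: "'a measure \<Rightarrow> (('a \<Rightarrow> real) \<Rightarrow> ereal) \<Rightarrow> 'a measure set" where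
  "determining_set M u = (GREATEST D. represents_utility M u D)"

lemma determining_set_eq_Union:
  assumes "coherent_utility M u"
  shows "determining_set M u = \<Union>{D. represents_utility M u D}"
    and "represents_utility M u (determining_set M u)"
proof -
  let ?U = "\<Union>{D. represents_utility M u D}"
  obtain D0 where D0: "represents_utility M u D0"
    using assms by (auto simp: coherent_utility_def)
  have "u Y = (INF Q\<in>?U. ext_expectation Q Y)" if Y: "Y \<in> borel_measurable M" for Y
  proof (rule antisym)
    show "u Y \<le> (INF Q\<in>?U. ext_expectation Q Y)"
    proof (rule INF_greatest)
      fix Q assume "Q \<in> ?U"
      then obtain D where "represents_utility M u D" "Q \<in> D" by auto
      then show "u Y \<le> ext_expectation Q Y"
        using Y by (auto simp: represents_utility_def intro: INF_lower)
    qed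
    have "(INF Q\<in>?U. ext_expectation Q Y) \<le> (INF Q\<in>D0. ext_expectation Q Y)"
      by (rule INF_superset_mono) (use D0 in auto)
    then show "(INF Q\<in>?U. ext_expectation Q Y) \<le> u Y"
      using D0 Y by (auto simp: represents_utility_def)
  qed
  then have U: "represents_utility M u ?U"
    using D0 unfolding represents_utility_def by blast
  show eq: "determining_set M u = ?U"
    unfolding determining_set_def by (rule Greatest_equality) (use U in auto)
  show "represents_utility M u (determining_set M u)"
    using U eq by simp
qed

text \<open>The context's \<open>L\<^sup>1\<^sub>w(D)\<close>; it depends on the determining set only through \<open>u\<close>.\<close>

definition L1_weak :: "'a measure \<Rightarrow> (('a \<Rightarrow> real) \<Rightarrow> ereal) \<Rightarrow> ('a \<Rightarrow> real) set" where
  "L1_weak M u = {Y \<in> borel_measurable M. u Y > -\<infinity> \<and> u (\<lambda>\<omega>. - Y \<omega>) > -\<infinity>}"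

text \<open>\<^const>\<open>real_of_ereal\<close> is harmless here: each component lies in \<^term>\<open>L1_weak M u\<close>, so
  its expectation is finite under every measure of the determining set.\<close>

definition expectation_vec :: "'a measure \<Rightarrow> ('a \<Rightarrow> real ^ 'd) \<Rightarrow> real ^ 'd" where
  "expectation_vec Q X = (\<chi> i. real_of_ereal (ext_expectation Q (\<lambda>\<omega>. X \<omega> $ i)))"

definition generator ::
    "'a measure \<Rightarrow> (('a \<Rightarrow> real) \<Rightarrow> ereal) \<Rightarrow> ('a \<Rightarrow> real ^ 'd) \<Rightarrow> (real ^ 'd) set" where
  "generator M u X = closure {expectation_vec Q X |Q. Q \<in> determining_set M u}"

definition polar_set :: "(real ^ 'd) set \<Rightarrow> (real ^ 'd) set" where
  "polar_set H = {x. \<forall>h\<in>H. h \<bullet> x \<le> 1}"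

text \<open>For compact \<open>H\<close> the polar is a neighbourhood of the origin, so for nonempty \<open>G\<close> the
  infimum below is over a nonempty set that is bounded below.\<close>

definition lambda_star :: "(real ^ 'd) set \<Rightarrow> (real ^ 'd) set \<Rightarrow> real" where
  "lambda_star G H = Inf {l. 0 \<le> l \<and> (\<lambda>x. l *\<^sub>R x) ` polar_set H \<inter> G \<noteq> {}}"

text \<open>The value \<open>{}\<close> for \<open>lambda_star G H = 0\<close> is not the set of maximizers: \<open>h = 0\<close> is then always
  a maximizer over \<open>H\<close>.\<close>

definition normal_set :: "(real ^ 'd) set \<Rightarrow> (real ^ 'd) set \<Rightarrow> (real ^ 'd) set" where
  "normal_set G H =
     (if lambda_star G H > 0
      then {h. \<forall>x \<in> (\<lambda>x. lambda_star G H *\<^sub>R x) ` polar_set H. \<forall>y\<in>G.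
                 h \<bullet> x \<le> lambda_star G H \<and> lambda_star G H \<le> h \<bullet> y}
      else {})"

end

theory Submission
  imports Defs
begin

text \<open>Since each component of \<open>X\<close> is integrable under every measure of the determining set,
  \<open>u (\<langle>h, X\<rangle>) = inf {\<langle>h, y\<rangle> | y \<in> G}\<close>, and \<open>\<langle>h, y\<rangle> \<le> \<lambda>\<close> whenever \<open>h \<in> H\<close> and \<open>y \<in> \<lambda> H\<^sup>*\<close>; this
  bounds the supremum by \<open>\<lambda>\<^sub>*\<close>. If \<open>\<lambda>\<^sub>* > 0\<close>, then \<open>G\<close> is disjoint from the union of the \<open>\<lambda> H\<^sup>*\<close> with
  \<open>\<lambda> < \<lambda>\<^sub>*\<close>. Both sets are convex (for \<open>G\<close>, because the largest determining set contains all mixtures of its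
  members), the second is a neighbourhood of \<open>0\<close>, and a separating functional, scaled to the level \<open>\<lambda>\<^sub>*\<close>, belongs to the bipolar of \<open>H\<close>, which is \<open>H\<close>. So the bound is attained.\<close>

section \<open>Extended expectations and integrability\<close>

lemma ext_expectation_eq:
  "ext_expectation Q Y =
    (let p = \<integral>\<^sup>+\<omega>. ennreal (Y \<omega>) \<partial>Q; n = \<integral>\<^sup>+\<omega>. ennreal (- Y \<omega>) \<partial>Q
     in if p = \<infinity> \<and> n = \<infinity> then -\<infinity> else enn2ereal p - enn2ereal n)"
  by (simp add: ext_expectation_def)

lemma ext_expectation_integrable:
  assumes "integrable Q Y"
  shows "ext_expectation Q Y = ereal (integral\<^sup>L Q Y)"
proof -
  obtain p n where "(\<integral>\<^sup>+\<omega>. ennreal (Y \<omega>) \<partial>Q) = ennreal p" "(\<integral>\<^sup>+\<omega>. ennreal (- Y \<omega>) \<partial>Q) = ennreal n"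
    "0 \<le> p" "0 \<le> n"
    using assms by (metis ennreal_cases infinity_ennreal_def real_integrable_def)
  then show ?thesis
    using assms by (simp add: ext_expectation_eq real_lebesgue_integral_def enn2ereal_ennreal)
qed

text \<open>An infinite negative part forces the value minus infinity: by subtraction if the
  positive part is finite, by the convention for infinity minus infinity otherwise.\<close>

lemma nn_integral_neg_part_finite:
  assumes "ext_expectation Q Y > -\<infinity>"
  shows "(\<integral>\<^sup>+\<omega>. ennreal (- Y \<omega>) \<partial>Q) < \<infinity>"
proof (rule ccontr)
  assume "\<not> ?thesis"
  then have n: "(\<integral>\<^sup>+\<omega>. ennreal (- Y \<omega>) \<partial>Q) = \<infinity>"
    by (simp add: not_less top_unique)
  have "enn2ereal p - \<infinity> = -\<infinity>" if "p \<noteq> \<infinity>" for p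
    using that by (cases p) auto
  with assms n show False
    unfolding ext_expectation_eq by (auto simp: Let_def top_ennreal.rep_eq split: if_splits)
qed

lemma integrable_if_ext_expectation:
  assumes [measurable]: "Y \<in> borel_measurable Q"
    and "ext_expectation Q Y > -\<infinity>" and "ext_expectation Q (\<lambda>\<omega>. - Y \<omega>) > -\<infinity>"
  shows "integrable Q Y"
proof -
  have "(\<integral>\<^sup>+\<omega>. ennreal (Y \<omega>) \<partial>Q) < \<infinity>" "(\<integral>\<^sup>+\<omega>. ennreal (- Y \<omega>) \<partial>Q) < \<infinity>"
    using nn_integral_neg_part_finite[OF assms(2)] nn_integral_neg_part_finite[OF assms(3)] by auto
  then show ?thesis
    by (auto simp: real_integrable_def)
qed

section \<open>Mixtures of absolutely continuous probabilities\<close>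

lemma abs_cont_probs_mixture:
  fixes M :: "'a measure" and t :: real
  assumes "prob_space M" and Q1: "Q1 \<in> abs_cont_probs M" and Q2: "Q2 \<in> abs_cont_probs M"
    and t: "0 < t" "t < 1"
  obtains Q where "Q \<in> abs_cont_probs M"
    and "\<And>f. f \<in> borel_measurable M \<Longrightarrow>
      nn_integral Q f = ennreal (1 - t) * nn_integral Q1 f + ennreal t * nn_integral Q2 f"
proof -
  interpret M: prob_space M by fact
  define d1 where "d1 = RN_deriv M Q1"
  define d2 where "d2 = RN_deriv M Q2"
  have d1: "density M d1 = Q1" and d2: "density M d2 = Q2"
    using M.density_RN_deriv[of Q1] M.density_RN_deriv[of Q2] Q1 Q2
    by (auto simp: abs_cont_probs_def d1_def d2_def)
  have [measurable]: "d1 \<in> borel_measurable M" "d2 \<in> borel_measurable M"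
    by (simp_all add: d1_def d2_def)
  \<comment> \<open>Mixing the densities gives absolute continuity at once. The mixture identity is
    proved for nonnegative integrals, where it needs no integrability; both
    \<open>ext_expectation\<close> and the Lebesgue integral are built from these.\<close>
  define Q where "Q = density M (\<lambda>\<omega>. ennreal (1 - t) * d1 \<omega> + ennreal t * d2 \<omega>)"
  have Q: "nn_integral Q f = ennreal (1 - t) * nn_integral Q1 f + ennreal t * nn_integral Q2 f"
    if [measurable]: "f \<in> borel_measurable M" for f
    unfolding Q_def d1[symmetric] d2[symmetric]
    by (simp add: nn_integral_density distrib_right mult.assoc nn_integral_add nn_integral_cmult)
  have "emeasure Q (space Q) = nn_integral Q (\<lambda>_. 1)"
    by simp
  also have "\<dots> = ennreal (1 - t) * emeasure Q1 (space Q1) + ennreal t * emeasure Q2 (space Q2)"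
    by (subst Q) auto
  also have "\<dots> = 1"
    using Q1 Q2 t
    by (simp add: abs_cont_probs_def prob_space.emeasure_space_1 flip: ennreal_plus)
  finally have "prob_space Q"
    by (rule prob_spaceI)
  moreover have "absolutely_continuous M Q"
    unfolding Q_def by (rule absolutely_continuousI_density) measurable
  ultimately have "Q \<in> abs_cont_probs M"
    by (auto simp: abs_cont_probs_def Q_def)
  with Q that show thesis
    by blast
qed

text \<open>For \<open>e\<close> above minus infinity, both negative parts are finite, hence so is
  that of the mixture. If a positive part is infinite, its positive weight makes the mixed
  expectation infinite; otherwise everything is a convex combination of reals.\<close>

lemma ext_expectation_mixture_ge:
  assumes t: "0 < t" "t < 1"
    and Q: "\<And>f. f \<in> borel_measurable M \<Longrightarrow>
      nn_integral Q f = ennreal (1 - t) * nn_integral Q1 f + ennreal t * nn_integral Q2 f"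
    and [measurable]: "Y \<in> borel_measurable M"
    and e: "e \<le> ext_expectation Q1 Y" "e \<le> ext_expectation Q2 Y"
  shows "e \<le> ext_expectation Q Y"
proof (cases "e = -\<infinity>")
  case False
  let ?p = "\<lambda>Q. \<integral>\<^sup>+\<omega>. ennreal (Y \<omega>) \<partial>Q"
  let ?n = "\<lambda>Q. \<integral>\<^sup>+\<omega>. ennreal (- Y \<omega>) \<partial>Q"
  have "-\<infinity> < ext_expectation Q1 Y" "-\<infinity> < ext_expectation Q2 Y"
    using e False by auto
  then have "?n Q1 < \<infinity>" "?n Q2 < \<infinity>"
    by (blast intro: nn_integral_neg_part_finite)+
  then obtain n1 n2 where n: "?n Q1 = ennreal n1" "?n Q2 = ennreal n2" "0 \<le> n1" "0 \<le> n2"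
    by (metis ennreal_cases infinity_ennreal_def less_irrefl)
  have nQ: "?n Q = ennreal ((1 - t) * n1 + t * n2)"
    using t n by (simp add: Q flip: ennreal_mult ennreal_plus)
  show ?thesis
  proof (cases "?p Q1 = \<infinity> \<or> ?p Q2 = \<infinity>")
    case True
    then have "?p Q = \<infinity>"
      using t by (auto simp: Q ennreal_mult_top ennreal_top_mult)
    then show ?thesis
      using t n by (simp add: ext_expectation_eq nQ enn2ereal_ennreal top_ennreal.rep_eq)
  next
    case False
    then obtain p1 p2 where p: "?p Q1 = ennreal p1" "?p Q2 = ennreal p2" "0 \<le> p1" "0 \<le> p2"
      by (metis ennreal_cases infinity_ennreal_def)
    have pQ: "?p Q = ennreal ((1 - t) * p1 + t * p2)"
      using t p by (simp add: Q flip: ennreal_mult ennreal_plus)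
    have E: "ext_expectation Q1 Y = ereal (p1 - n1)" "ext_expectation Q2 Y = ereal (p2 - n2)"
      using p n by (simp_all add: ext_expectation_eq enn2ereal_ennreal)
    have "ext_expectation Q Y = ereal ((1 - t) * (p1 - n1) + t * (p2 - n2))"
    proof -
      have "0 \<le> (1 - t) * p1 + t * p2" "0 \<le> (1 - t) * n1 + t * n2"
        using t p n by simp_all
      then have "ext_expectation Q Y = ereal ((1 - t) * p1 + t * p2 - ((1 - t) * n1 + t * n2))"
        unfolding ext_expectation_eq pQ nQ by (simp add: enn2ereal_ennreal del: ennreal_plus)
      then show ?thesis
        by (simp add: algebra_simps)
    qed
    \<comment> \<open>\<open>convex_bound_le\<close> bounds from above, hence the changes of
      sign.\<close>
    moreover have "min (p1 - n1) (p2 - n2) \<le> (1 - t) * (p1 - n1) + t * (p2 - n2)"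
      using t convex_bound_le[of "- (p1 - n1)" "- min (p1 - n1) (p2 - n2)" "- (p2 - n2)" "1 - t" t]
      by (simp add: algebra_simps)
    moreover have "e \<le> ereal (min (p1 - n1) (p2 - n2))"
      using e by (simp add: E min_def)
    ultimately show ?thesis
      by (metis ereal_less_eq(3) order_trans)
  qed
qed simp

lemma integral_mixture:
  fixes Y :: "'a \<Rightarrow> real"
  assumes t: "0 < t" "t < 1"
    and Q: "\<And>f. f \<in> borel_measurable M \<Longrightarrow>
      nn_integral Q f = ennreal (1 - t) * nn_integral Q1 f + ennreal t * nn_integral Q2 f"
    and [measurable]: "Y \<in> borel_measurable M"
    and int: "integrable Q Y" "integrable Q1 Y" "integrable Q2 Y"
  shows "integral\<^sup>L Q Y = (1 - t) * integral\<^sup>L Q1 Y + t * integral\<^sup>L Q2 Y"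
proof -
  have fin: "nn_integral R (\<lambda>\<omega>. ennreal (Z \<omega>)) < \<top>" if "integrable R Z" for R and Z :: "'a \<Rightarrow> real"
    using that by (simp add: real_integrable_def less_top)
  \<comment> \<open>\<open>enn2real\<close> sends infinity to 0 and is additive only on finite
    values, which \<open>fin\<close> provides. The equation serves for \<open>Y\<close> and for its
    negative.\<close>
  have eq: "enn2real (nn_integral Q (\<lambda>\<omega>. ennreal (Z \<omega>))) =
      (1 - t) * enn2real (nn_integral Q1 (\<lambda>\<omega>. ennreal (Z \<omega>))) +
      t * enn2real (nn_integral Q2 (\<lambda>\<omega>. ennreal (Z \<omega>)))"
    if [measurable]: "Z \<in> borel_measurable M" and "integrable Q1 Z" "integrable Q2 Z" for Z
    using t fin[of Q1 Z] fin[of Q2 Z] that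
    by (simp add: Q enn2real_plus enn2real_mult ennreal_mult_less_top)
  show ?thesis
    using int by (simp add: real_lebesgue_integral_def eq algebra_simps)
qed

section \<open>Membership in the determining set\<close>

lemma determining_set_lower:
  assumes "coherent_utility M u" "Q \<in> determining_set M u" "Y \<in> borel_measurable M"
  shows "u Y \<le> ext_expectation Q Y"
  using determining_set_eq_Union(2)[OF assms(1)] assms(2,3)
  by (auto simp: represents_utility_def intro: INF_lower)

text \<open>Adding such a \<open>Q\<close> leaves every infimum unchanged, so the enlarged set still
  represents \<open>u\<close>, and the determining set is the union of all representing
  sets.\<close>

lemma determining_setI:
  assumes u: "coherent_utility M u" and "Q \<in> abs_cont_probs M"
    and le: "\<And>Y. Y \<in> borel_measurable M \<Longrightarrow> u Y \<le> ext_expectation Q Y"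
  shows "Q \<in> determining_set M u"
proof -
  have "represents_utility M u (insert Q (determining_set M u))"
    using determining_set_eq_Union(2)[OF u] assms(2) le
    by (auto simp: represents_utility_def inf_absorb2)
  then show ?thesis
    using determining_set_eq_Union(1)[OF u] by blast
qed

text \<open>The values of \<open>u\<close> at \<open>Y\<close> and at its negative bound both
  expectations under \<open>Q\<close> from below, which makes both parts of \<open>Y\<close>
  finite.\<close>

lemma L1_weak_integrable:
  assumes "coherent_utility M u" "Q \<in> determining_set M u" "Y \<in> L1_weak M u"
  shows "integrable Q Y"
proof (rule integrable_if_ext_expectation)
  have Y: "Y \<in> borel_measurable M" "-\<infinity> < u Y" "-\<infinity> < u (\<lambda>\<omega>. - Y \<omega>)"
    using assms(3) by (auto simp: L1_weak_def)
  have "sets Q = sets M"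
    using determining_set_eq_Union(2)[OF assms(1)] assms(2)
    by (auto simp: represents_utility_def abs_cont_probs_def)
  then show "Y \<in> borel_measurable Q"
    using Y(1) by (simp cong: measurable_cong_sets)
  show "-\<infinity> < ext_expectation Q Y"
    using Y determining_set_lower[OF assms(1,2)] by (blast intro: less_le_trans)
  show "-\<infinity> < ext_expectation Q (\<lambda>\<omega>. - Y \<omega>)"
    using Y determining_set_lower[OF assms(1,2), of "\<lambda>\<omega>. - Y \<omega>"]
    by (auto intro: less_le_trans)
qed

section \<open>Scalar products and the generator\<close>

lemma
  fixes X :: "'a \<Rightarrow> real ^ 'd"
  assumes "\<And>i. integrable Q (\<lambda>\<omega>. X \<omega> $ i)"
  shows integrable_inner_vec: "integrable Q (\<lambda>\<omega>. h \<bullet> X \<omega>)"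
    and ext_expectation_inner:
      "ext_expectation Q (\<lambda>\<omega>. h \<bullet> X \<omega>) = ereal (h \<bullet> expectation_vec Q X)"
proof -
  show i: "integrable Q (\<lambda>\<omega>. h \<bullet> X \<omega>)"
    unfolding inner_vec_def using assms by auto
  have "integral\<^sup>L Q (\<lambda>\<omega>. h \<bullet> X \<omega>) = h \<bullet> expectation_vec Q X"
    unfolding inner_vec_def expectation_vec_def using assms
    by (simp add: ext_expectation_integrable)
  then show "ext_expectation Q (\<lambda>\<omega>. h \<bullet> X \<omega>) = ereal (h \<bullet> expectation_vec Q X)"
    by (simp add: ext_expectation_integrable i)
qed

lemma inner_vec_borel_measurable:
  fixes X :: "'a \<Rightarrow> real ^ 'd"
  assumes "\<And>i. (\<lambda>\<omega>. X \<omega> $ i) \<in> borel_measurable M"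
  shows "(\<lambda>\<omega>. h \<bullet> X \<omega>) \<in> borel_measurable M"
  unfolding inner_vec_def using assms by measurable

lemma generator_nonempty:
  assumes "coherent_utility M u"
  shows "generator M u X \<noteq> {}"
  using determining_set_eq_Union(2)[OF assms]
  by (auto simp: represents_utility_def generator_def)

text \<open>A mixture of two members of the determining set still dominates \<open>u\<close>, so it
  is a member by maximality, and its expectation vector is the mixture of theirs.\<close>

lemma convex_generator:
  fixes X :: "'a \<Rightarrow> real ^ 'd"
  assumes "prob_space M" and u: "coherent_utility M u"
    and X: "\<And>i. (\<lambda>\<omega>. X \<omega> $ i) \<in> L1_weak M u"
  shows "convex (generator M u X)"
  unfolding generator_def
\<comment> \<open>Open segments leave only weights strictly between 0 and 1, as the mixture lemmas
  require.\<close>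
proof (intro convex_closure, unfold convex_contains_open_segment, safe)
  fix Q1 Q2 x
  assume Q: "Q1 \<in> determining_set M u" "Q2 \<in> determining_set M u"
    and "x \<in> open_segment (expectation_vec Q1 X) (expectation_vec Q2 X)"
  then obtain t where t: "0 < t" "t < 1"
    and x: "x = (1 - t) *\<^sub>R expectation_vec Q1 X + t *\<^sub>R expectation_vec Q2 X"
    by (auto simp: in_segment)
  have "Q1 \<in> abs_cont_probs M" "Q2 \<in> abs_cont_probs M"
    using determining_set_eq_Union(2)[OF u] Q by (auto simp: represents_utility_def)
  then obtain R where R: "R \<in> abs_cont_probs M"
    and mix: "\<And>f. f \<in> borel_measurable M \<Longrightarrow>
      nn_integral R f = ennreal (1 - t) * nn_integral Q1 f + ennreal t * nn_integral Q2 f"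
    using abs_cont_probs_mixture[OF assms(1) _ _ t] by blast
  have "u Y \<le> ext_expectation R Y" if "Y \<in> borel_measurable M" for Y
    using determining_set_lower[OF u] Q that
    by (intro ext_expectation_mixture_ge[OF t mix]) auto
  then have RD: "R \<in> determining_set M u"
    using u R by (intro determining_setI) auto
  have "expectation_vec R X $ i = x $ i" for i
  proof -
    let ?Y = "\<lambda>\<omega>. X \<omega> $ i"
    have [measurable]: "?Y \<in> borel_measurable M"
      using X by (auto simp: L1_weak_def)
    have int: "integrable Q1 ?Y" "integrable Q2 ?Y" "integrable R ?Y"
      using L1_weak_integrable[OF u _ X] Q RD by auto
    then show ?thesis
      using integral_mixture[OF t mix, where Y = ?Y]
      by (simp add: x expectation_vec_def ext_expectation_integrable)
  qed
  then have "x = expectation_vec R X"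
    by (simp add: vec_eq_iff)
  then show "\<exists>Q. x = expectation_vec Q X \<and> Q \<in> determining_set M u"
    using RD by blast
qed

text \<open>Closed half-spaces contain a set exactly when they contain its closure. Testing against
  real lower bounds \<open>c\<close> transfers the infimum to the closure without computing it in
  the extended reals.\<close>

lemma ge_utility_inner_iff:
  fixes X :: "'a \<Rightarrow> real ^ 'd"
  assumes u: "coherent_utility M u"
    and X: "\<And>i. (\<lambda>\<omega>. X \<omega> $ i) \<in> L1_weak M u"
  shows "ereal c \<le> u (\<lambda>\<omega>. h \<bullet> X \<omega>) \<longleftrightarrow> (\<forall>y\<in>generator M u X. c \<le> h \<bullet> y)"
proof -
  let ?D = "determining_set M u"
  let ?G = "{expectation_vec Q X |Q. Q \<in> ?D}"
  have "(\<lambda>\<omega>. h \<bullet> X \<omega>) \<in> borel_measurable M"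
    using X by (intro inner_vec_borel_measurable) (auto simp: L1_weak_def)
  then have "u (\<lambda>\<omega>. h \<bullet> X \<omega>) = (INF Q\<in>?D. ext_expectation Q (\<lambda>\<omega>. h \<bullet> X \<omega>))"
    using determining_set_eq_Union(2)[OF u] by (simp add: represents_utility_def)
  also have "\<dots> = (INF Q\<in>?D. ereal (h \<bullet> expectation_vec Q X))"
    using L1_weak_integrable[OF u _ X] by (intro INF_cong) (auto intro!: ext_expectation_inner)
  finally have "ereal c \<le> u (\<lambda>\<omega>. h \<bullet> X \<omega>) \<longleftrightarrow> ?G \<subseteq> {y. c \<le> h \<bullet> y}"
    by (auto simp: le_INF_iff)
  also have "\<dots> \<longleftrightarrow> closure ?G \<subseteq> {y. c \<le> h \<bullet> y}"
    using closed_halfspace_ge[of c h] closure_subset[of ?G] closure_minimal[of ?G "{y. c \<le> h \<bullet> y}"]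
    by blast
  finally show ?thesis
    by (auto simp: generator_def)
qed

section \<open>Polars and the critical scaling level\<close>

lemma bipolar_subset:
  fixes H :: "(real ^ 'd) set"
  assumes H: "convex H" "closed H" "0 \<in> H" and a: "\<And>x. x \<in> polar_set H \<Longrightarrow> a \<bullet> x \<le> 1"
  shows "a \<in> H"
proof (rule ccontr)
  assume "a \<notin> H"
  then obtain w c where w: "w \<bullet> a < c" "\<And>h. h \<in> H \<Longrightarrow> c < w \<bullet> h"
    using separating_hyperplane_closed_point[OF H(1,2)] by blast
  from w(2)[OF H(3)] have c: "c < 0"
    by simp
  \<comment> \<open>As \<open>c\<close> is negative, dividing by it reverses both separating
    inequalities: values on \<open>H\<close> fall below 1, while the value at \<open>a\<close>
    exceeds 1.\<close>
  have "w /\<^sub>R c \<in> polar_set H"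
    unfolding polar_set_def
  proof safe
    fix h assume "h \<in> H"
    then show "h \<bullet> (w /\<^sub>R c) \<le> 1"
      using w(2)[of h] c by (simp add: inner_commute[of h] field_simps)
  qed
  from a[OF this] show False
    using w(1) c by (simp add: inner_commute[of a] field_simps)
qed

text \<open>Positivity of \<open>l\<close> matters: at 0 the left side describes only the origin,
  while the right side describes a cone that may be larger.\<close>

lemma mem_scaled_polar_iff:
  assumes "0 < l"
  shows "y \<in> (\<lambda>x. l *\<^sub>R x) ` polar_set H \<longleftrightarrow> (\<forall>h\<in>H. h \<bullet> y \<le> l)"
proof
  assume "\<forall>h\<in>H. h \<bullet> y \<le> l"
  then have "y /\<^sub>R l \<in> polar_set H"
    using assms by (auto simp: polar_set_def field_simps)
  then have "l *\<^sub>R (y /\<^sub>R l) \<in> (\<lambda>x. l *\<^sub>R x) ` polar_set H"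
    by (rule imageI)
  then show "y \<in> (\<lambda>x. l *\<^sub>R x) ` polar_set H"
    using assms by simp
qed (use assms in \<open>auto simp: polar_set_def\<close>)

lemma lambda_star_le:
  assumes "0 < l" "y \<in> G" "\<And>h. h \<in> H \<Longrightarrow> h \<bullet> y \<le> l"
  shows "lambda_star G H \<le> l"
proof -
  have "y \<in> (\<lambda>x. l *\<^sub>R x) ` polar_set H"
    using assms by (simp add: mem_scaled_polar_iff)
  then show ?thesis
    unfolding lambda_star_def using assms(1,2)
    by (intro cInf_lower bdd_belowI[where m = 0]) auto
qed

text \<open>Boundedness of \<open>H\<close> and a point of \<open>G\<close> supply an admissible
  level, so that \<open>Inf\<close> is not taken over the empty set.\<close>

lemma le_lambda_star:
  fixes G H :: "(real ^ 'd) set"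
  assumes "bounded H" "G \<noteq> {}"
    and le: "\<And>l x. 0 \<le> l \<Longrightarrow> x \<in> polar_set H \<Longrightarrow> l *\<^sub>R x \<in> G \<Longrightarrow> c \<le> l"
  shows "c \<le> lambda_star G H"
proof -
  obtain y where y: "y \<in> G"
    using assms(2) by blast
  obtain B where B: "0 < B" "\<And>h. h \<in> H \<Longrightarrow> norm h \<le> B"
    using assms(1) by (auto simp: bounded_pos)
  \<comment> \<open>Cauchy-Schwarz gives the product; adding 1 keeps \<open>l\<close> positive even
    for \<open>y = 0\<close>.\<close>
  define l where "l = B * norm y + 1"
  have "0 < l"
    using B(1) by (simp add: l_def add_nonneg_pos)
  moreover have "h \<bullet> y \<le> l" if "h \<in> H" for h
    using norm_cauchy_schwarz[of h y] mult_right_mono[OF B(2)[OF that] norm_ge_zero[of y]]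
    unfolding l_def by linarith
  ultimately have "y \<in> (\<lambda>x. l *\<^sub>R x) ` polar_set H"
    by (simp add: mem_scaled_polar_iff)
  then show ?thesis
    unfolding lambda_star_def using y \<open>0 < l\<close> le
    by (intro cInf_greatest) (auto intro: less_imp_le)
qed

lemma lambda_star_attained:
  fixes G H :: "(real ^ 'd) set"
  assumes "convex G" "G \<noteq> {}" and H: "convex H" "compact H" "0 \<in> H" and pos: "0 < lambda_star G H"
  obtains h where "h \<in> H" "\<And>y. y \<in> G \<Longrightarrow> lambda_star G H \<le> h \<bullet> y"
proof -
  define L where "L = lambda_star G H"
  \<comment> \<open>Since \<open>0\<close> is in \<open>H\<close>, no negative \<open>l\<close> can
    occur, and \<open>C\<close> is the union of the multiples of \<open>polar_set H\<close> by
    factors strictly between 0 and \<open>L\<close>.\<close>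
  define C where "C = {x. \<exists>l<L. \<forall>h\<in>H. h \<bullet> x \<le> l}"
  have "0 < L"
    using pos by (simp add: L_def)
  then have "0 \<in> C"
    by (auto simp: C_def)
  have "convex C"
    unfolding convex_alt
  proof (intro ballI allI impI)
    fix x y and t :: real
    assume xy: "x \<in> C" "y \<in> C" and t: "0 \<le> t \<and> t \<le> 1"
    from xy obtain l where l: "l < L" "\<And>h. h \<in> H \<Longrightarrow> h \<bullet> x \<le> l" "\<And>h. h \<in> H \<Longrightarrow> h \<bullet> y \<le> l"
    proof -
      obtain k m where "k < L" "\<forall>h\<in>H. h \<bullet> x \<le> k" "m < L" "\<forall>h\<in>H. h \<bullet> y \<le> m"
        using xy by (auto simp: C_def)
      then show thesis
        by (intro that[of "max k m"]) (auto simp: le_max_iff_disj)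
    qed
    have "h \<bullet> ((1 - t) *\<^sub>R x + t *\<^sub>R y) \<le> l" if "h \<in> H" for h
      using convex_bound_le[OF l(2)[OF that] l(3)[OF that], of "1 - t" t] t
      by (simp add: inner_add_right)
    then show "(1 - t) *\<^sub>R x + t *\<^sub>R y \<in> C"
      using l(1) by (auto simp: C_def)
  qed
  moreover have "C \<inter> G = {}"
  proof (rule ccontr)
    assume "C \<inter> G \<noteq> {}"
    then obtain y l where "y \<in> G" "l < L" "\<And>h. h \<in> H \<Longrightarrow> h \<bullet> y \<le> l"
      by (auto simp: C_def)
    \<comment> \<open>Taking the maximum with \<open>L / 2\<close> makes the level positive, as
      \<open>lambda_star_le\<close> demands, and keeps it below \<open>L\<close>.\<close>
    then have "lambda_star G H \<le> max l (L / 2)"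
      using \<open>0 < L\<close> by (intro lambda_star_le[of _ y]) (auto simp: le_max_iff_disj)
    then show False
      using \<open>0 < L\<close> \<open>l < L\<close> by (auto simp: L_def)
  qed
  ultimately obtain a b where "a \<noteq> 0" and aC: "\<And>x. x \<in> C \<Longrightarrow> a \<bullet> x \<le> b"
    and aG: "\<And>y. y \<in> G \<Longrightarrow> b \<le> a \<bullet> y"
    using separating_hyperplane_sets[of C G] assms(1,2) \<open>0 \<in> C\<close> by blast
  have scale: "s *\<^sub>R x \<in> C" if "x \<in> polar_set H" "0 \<le> s" "s < L" for x s
    using that by (auto simp: C_def polar_set_def intro!: exI[of _ s] mult_left_le)
  obtain B where B: "0 < B" "\<And>h. h \<in> H \<Longrightarrow> norm h \<le> B"
    using compact_imp_bounded[OF H(2)] by (auto simp: bounded_pos)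
  \<comment> \<open>A positive multiple of \<open>a\<close> lies in the polar, so \<open>C\<close>
    contains a point where the functional is positive. This makes \<open>b\<close> positive.\<close>
  have "a /\<^sub>R (B * norm a) \<in> polar_set H"
    unfolding polar_set_def
  proof safe
    fix h assume "h \<in> H"
    have "h \<bullet> a \<le> B * norm a"
      using norm_cauchy_schwarz[of h a] mult_right_mono[OF B(2)[OF \<open>h \<in> H\<close>] norm_ge_zero[of a]]
      by linarith
    then show "h \<bullet> (a /\<^sub>R (B * norm a)) \<le> 1"
      using B(1) \<open>a \<noteq> 0\<close> by (simp add: field_simps)
  qed
  from aC[OF scale[OF this, of "L / 2"]] have "L / 2 * (norm a / B) \<le> b"
    using \<open>0 < L\<close> B(1) \<open>a \<noteq> 0\<close> by (simp add: dot_square_norm power2_eq_square field_simps)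
  moreover have "0 < L / 2 * (norm a / B)"
    using \<open>0 < L\<close> B(1) \<open>a \<noteq> 0\<close> by simp
  ultimately have "0 < b"
    by linarith
  \<comment> \<open>The scaling moves the separating level from \<open>b\<close> to
    \<open>L\<close>.\<close>
  let ?h = "(L / b) *\<^sub>R a"
  have "?h \<in> H"
  proof (rule bipolar_subset)
    fix x assume x: "x \<in> polar_set H"
    have "s * (a \<bullet> x) \<le> b" if "0 < s" "s < L" for s
      using aC[OF scale[OF x, of s]] that by simp
    \<comment> \<open>\<open>C\<close> contains the multiples of the polar only for factors below
      \<open>L\<close>; letting \<open>s\<close> tend to \<open>L\<close> from the left gives the
      bound at \<open>L\<close> itself.\<close>
    then have "L * (a \<bullet> x) \<le> b"
    proof -
      have "((\<lambda>s. s * (a \<bullet> x)) \<longlongrightarrow> L * (a \<bullet> x)) (at_left L)"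
        by (intro tendsto_intros)
      moreover have "eventually (\<lambda>s. s * (a \<bullet> x) \<le> b) (at_left L)"
        using \<open>0 < L\<close> \<open>\<And>s. 0 < s \<Longrightarrow> s < L \<Longrightarrow> s * (a \<bullet> x) \<le> b\<close>
        by (auto simp: eventually_at_left intro!: exI[of _ 0])
      ultimately show ?thesis
        by (rule tendsto_upperbound) simp
    qed
    then show "?h \<bullet> x \<le> 1"
      using \<open>0 < b\<close> by (simp add: field_simps)
  qed (use H compact_imp_closed in auto)
  moreover have "lambda_star G H \<le> ?h \<bullet> y" if "y \<in> G" for y
    using aG[OF that] \<open>0 < b\<close> \<open>0 < L\<close> by (simp add: field_simps flip: L_def)
  ultimately show thesis
    by (rule that)
qed

text \<open>At level 0 the supremum is 0 and is attained at \<open>h = 0\<close>, so the argmax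
  cannot be the empty \<open>normal_set\<close>; that case describes the maximizers
  directly.\<close>

theorem theorem2p10:
  fixes M :: "'a measure" and u :: "('a \<Rightarrow> real) \<Rightarrow> ereal"
    and X :: "'a \<Rightarrow> real ^ 'd" and H :: "(real ^ 'd) set"
  assumes "prob_space M"
    and "coherent_utility M u"
    and "\<And>i. (\<lambda>\<omega>. X \<omega> $ i) \<in> L1_weak M u"
    and "convex H" and "compact H" and "0 \<in> H"
  shows "(SUP h\<in>H. u (\<lambda>\<omega>. h \<bullet> X \<omega>)) = ereal (lambda_star (generator M u X) H) \<and>
    (lambda_star (generator M u X) H > 0 \<longrightarrow>
      {h. is_arg_max (\<lambda>h. u (\<lambda>\<omega>. h \<bullet> X \<omega>)) (\<lambda>h. h \<in> H) h} = normal_set (generator M u X) H) \<and>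
    (lambda_star (generator M u X) H = 0 \<longrightarrow>
      {h. is_arg_max (\<lambda>h. u (\<lambda>\<omega>. h \<bullet> X \<omega>)) (\<lambda>h. h \<in> H) h} =
        {h \<in> H. \<forall>y \<in> generator M u X. 0 \<le> h \<bullet> y})"
proof -
  let ?G = "generator M u X" and ?f = "\<lambda>h. u (\<lambda>\<omega>. h \<bullet> X \<omega>)"
  let ?L = "lambda_star ?G H"
  note iff = ge_utility_inner_iff[OF assms(2,3)]
  have G: "convex ?G" "?G \<noteq> {}"
    using assms(1-3) by (auto intro: convex_generator dest: generator_nonempty)
  have L_nonneg: "0 \<le> ?L"
    using compact_imp_bounded[OF assms(5)] G(2) by (rule le_lambda_star)
  have upper: "?f h \<le> ereal ?L" if h: "h \<in> H" for h
  proof (rule ccontr)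
    assume "\<not> ?f h \<le> ereal ?L"
    \<comment> \<open>A real \<open>c\<close> strictly in between also covers an infinite value of
      \<open>u\<close>.\<close>
    then obtain c where c: "?L < c" "ereal c \<le> ?f h"
      using ereal_dense2[of "ereal ?L" "?f h"] by (auto simp: not_le intro: less_imp_le)
    have "c \<le> ?L"
      using compact_imp_bounded[OF assms(5)] G(2)
    proof (rule le_lambda_star)
      fix l x assume lx: "0 \<le> l" "x \<in> polar_set H" "l *\<^sub>R x \<in> ?G"
      then have "c \<le> l * (h \<bullet> x)"
        using c(2) by (auto simp: iff)
      also have "\<dots> \<le> l"
        using lx h by (intro mult_left_le) (auto simp: polar_set_def)
      finally show "c \<le> l" .
    qed
    with c(1) show False
      by simp
  qed
  obtain h0 where h0: "h0 \<in> H" "\<And>y. y \<in> ?G \<Longrightarrow> ?L \<le> h0 \<bullet> y"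
  proof (cases "0 < ?L")
    case True
    with G assms(4-6) that show thesis
      using lambda_star_attained by metis
  next
    \<comment> \<open>At level 0 the zero vector attains the bound.\<close>
    case False
    with L_nonneg that[of 0] assms(6) show thesis
      by auto
  qed
  then have h0_ge: "ereal ?L \<le> ?f h0"
    by (simp add: iff)
  have sup: "(SUP h\<in>H. ?f h) = ereal ?L"
    using h0(1) h0_ge upper by (intro antisym SUP_least) (auto intro: SUP_upper2)
  have "is_arg_max ?f (\<lambda>h. h \<in> H) h \<longleftrightarrow> h \<in> H \<and> ereal ?L \<le> ?f h" for h
    using h0(1) h0_ge upper unfolding is_arg_max_linorder by (meson order_trans)
  then have argmax: "{h. is_arg_max ?f (\<lambda>h. h \<in> H) h} = {h \<in> H. \<forall>y\<in>?G. ?L \<le> h \<bullet> y}"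
    by (simp add: iff)
  have "{h \<in> H. \<forall>y\<in>?G. ?L \<le> h \<bullet> y} = normal_set ?G H" if "0 < ?L"
  proof -
    have "(\<forall>x\<in>polar_set H. h \<bullet> x \<le> 1) \<longleftrightarrow> h \<in> H" for h
    proof
      assume "\<forall>x\<in>polar_set H. h \<bullet> x \<le> 1"
      then show "h \<in> H"
        using bipolar_subset[OF assms(4) compact_imp_closed[OF assms(5)] assms(6)] by blast
    qed (auto simp: polar_set_def)
    then have "(\<forall>x\<in>(\<lambda>x. ?L *\<^sub>R x) ` polar_set H. h \<bullet> x \<le> ?L) \<longleftrightarrow> h \<in> H" for h
      using that by simp
    \<comment> \<open>\<open>normal_set\<close> quantifies jointly over the scaled polar and
      \<open>G\<close>; splitting its two inequalities requires both sets to be nonempty.\<close>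
    moreover have "0 \<in> polar_set H"
      by (simp add: polar_set_def)
    then have "(\<lambda>x. ?L *\<^sub>R x) ` polar_set H \<noteq> {}"
      by blast
    ultimately show ?thesis
      unfolding normal_set_def if_P[OF that] using G(2) by blast
  qed
  with sup argmax show ?thesis
    using L_nonneg by auto
qed

end
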